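(* For $n\ge 1$, \[ L_n(x)=x\sum_{k=0}^{n-1}\binom{n-1}{k}C_n(n-1-k;1)(x-1)^k . \]
   Context: $L_n(x)=\sum_{k=1}^{n}\binom{n-1}{k-1}\frac{n!}{k!}(-x)^k$ (the Laguerre sequence, associated to the delta series $t/(t-1)$). For $a\neq0$, $C_n(x;a)=\sum_{k=0}^{n}\binom{n}{k}(-1)^{n-k}a^{-k}(x)_k$ are the Poisson–Charlier polynomials, with $(x)_k=x(x-1)\cdots(x-k+1)$. *)

theory Defs
  imports "HOL-Computational_Algebra.Polynomial"
begin

text \<open>
  All polynomials are formal polynomials over an arbitrary field of characteristic \<open>0\<close>;
  \<open>[:0, 1:]\<close> is the indeterminate \<open>x\<close>.
\<close>

definition falling_poly :: "nat \<Rightarrow> 'a::field_char_0 poly" where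
  "falling_poly k = (\<Prod>i<k. [:0, 1:] - of_nat i)"

text \<open>
  Laguerre sequence (associated to \<open>t / (t - 1)\<close>), given by its explicit formula for \<open>n \<ge> 1\<close>.
  At \<open>n = 0\<close> the sum is empty and the value \<open>0\<close> has no significance.
\<close>

definition laguerre :: "nat \<Rightarrow> 'a::field_char_0 poly" where
  "laguerre n =
     (\<Sum>k = 1..n. smult (of_nat ((n - 1) choose (k - 1)) * (fact n / fact k)) ((- [:0, 1:]) ^ k))"

text \<open>Poisson-Charlier polynomial \<open>C\<^sub>n(x; a)\<close>; meaningful only for \<open>a \<noteq> 0\<close>.\<close>

definition poisson_charlier :: "nat \<Rightarrow> 'a \<Rightarrow> 'a::field_char_0 poly" where
  "poisson_charlier n a =
     (\<Sum>k = 0..n. smult (of_nat (n choose k) * (- 1) ^ (n - k) * inverse (a ^ k)) (falling_poly k))"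

end

theory Submission
  imports Defs
begin

text \<open>
  Expand each power \<open>x\<^sup>j\<close> in \<open>L\<^sub>n(x) / x\<close> in powers of \<open>x - 1\<close>. With \<open>m = n - 1\<close> and
  \<open>j = m - i\<close>, the identity \<open>(m choose j) (j choose k) = (m choose k) (m - k choose i)\<close> turns the
  coefficient of \<open>(x - 1)\<^sup>k\<close>, term by term, into \<open>(m choose k) C\<^sub>n(m - k; 1)\<close>.
\<close>

lemma poly_falling_poly_of_nat:
  "poly (falling_poly i) (of_nat M :: 'a::field_char_0) = fact i * of_nat (M choose i)"
  by (simp add: falling_poly_def poly_prod binomial_gbinomial gbinomial_prod_rev
      atLeast0LessThan)

text \<open>The factor \<open>fact i\<close> of the falling factorial at \<open>M\<close> turns
  \<open>Suc m choose i\<close> into \<open>fact (Suc m) / fact (Suc m - i)\<close>, the shape of a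
  Laguerre coefficient.\<close>

lemma poly_poisson_charlier_1_of_nat:
  assumes "M \<le> m"
  shows "poly (poisson_charlier (Suc m) 1) (of_nat M :: 'a::field_char_0) =
    (\<Sum>i\<le>m. of_nat (M choose i) * (fact (Suc m) / fact (Suc m - i)) * (- 1) ^ (Suc m - i))"
proof -
  have "poly (poisson_charlier (Suc m) 1) (of_nat M :: 'a) =
    (\<Sum>i\<le>Suc m. of_nat (Suc m choose i) * (- 1) ^ (Suc m - i) * (fact i * of_nat (M choose i)))"
    unfolding poisson_charlier_def
    by (simp only: poly_sum poly_smult poly_falling_poly_of_nat power_one inverse_1 mult_1_right
        atLeast0AtMost)
  also have "\<dots> =
    (\<Sum>i\<le>Suc m. of_nat (M choose i) * (fact (Suc m) / fact (Suc m - i)) * (- 1) ^ (Suc m - i))"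
  proof (rule sum.cong[OF refl])
    fix i assume "i \<in> {..Suc m}"
    then have "(of_nat (Suc m choose i) :: 'a) = fact (Suc m) / (fact i * fact (Suc m - i))"
      by (intro binomial_fact) simp
    then show "of_nat (Suc m choose i) * (- 1) ^ (Suc m - i) * (fact i * of_nat (M choose i)) =
      of_nat (M choose i) * (fact (Suc m) / fact (Suc m - i)) * (- 1 :: 'a) ^ (Suc m - i)"
      by (simp del: fact_Suc binomial_Suc_Suc)
  qed
  \<comment> \<open>The term \<open>i = Suc m\<close> vanishes because \<open>M \<le> m\<close>; the
    remaining range is that of the coefficients of \<open>laguerre (Suc m)\<close> after division by
    \<open>x\<close>.\<close>
  also have "\<dots> =
    (\<Sum>i\<le>m. of_nat (M choose i) * (fact (Suc m) / fact (Suc m - i)) * (- 1) ^ (Suc m - i))"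
    using assms by (simp add: binomial_eq_0)
  finally show ?thesis .
qed

text \<open>Both sides count pairs of disjoint subsets, of sizes \<open>k\<close> and
  \<open>i\<close>, of an \<open>m\<close>-element set: the left side first picks the complement of
  the \<open>i\<close>-set, the right side first picks the \<open>k\<close>-set.\<close>

lemma choose_diff_mult_choose:
  assumes "i \<le> m" "k \<le> m"
  shows "(m choose (m - i)) * ((m - i) choose k) = (m choose k) * ((m - k) choose i)"
proof (cases "k \<le> m - i")
  case True
  then have "(m choose (m - i)) * ((m - i) choose k) = (m choose k) * ((m - k) choose (m - i - k))"
    by (intro choose_mult) auto
  also have "(m - k) choose (m - i - k) = (m - k) choose i"
    using assms True binomial_symmetric[of i "m - k"] by (simp add: add.commute)
  finally show ?thesis .
next
  case False
  \<comment> \<open>Here \<open>m - k < i\<close>, so both sides are 0.\<close>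
  with assms show ?thesis by (simp add: binomial_eq_0)
qed

text \<open>Under \<open>j = m - i\<close> one has \<open>Suc j = Suc m - i\<close>, so factorials
  and signs already agree with the Poisson-Charlier value; only the binomial products need
  rewriting.\<close>

lemma sum_laguerre_coeff_choose:
  assumes "k \<le> m"
  shows "(\<Sum>j\<le>m. of_nat (m choose j) * (fact (Suc m) / fact (Suc j)) * (- 1) ^ Suc j *
      of_nat (j choose k)) =
    of_nat (m choose k) * poly (poisson_charlier (Suc m) 1) (of_nat (m - k) :: 'a::field_char_0)"
    (is "(\<Sum>j\<le>m. ?g j) = _")
proof -
  have "(\<Sum>j\<le>m. ?g j) = (\<Sum>i\<le>m. ?g (m - i))"
    using sum.nat_diff_reindex[of ?g "Suc m"] by (simp add: lessThan_Suc_atMost)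
  also have "\<dots> = (\<Sum>i\<le>m. of_nat (m choose k) *
      (of_nat ((m - k) choose i) * (fact (Suc m) / fact (Suc m - i)) * (- 1) ^ (Suc m - i)))"
  proof (rule sum.cong[OF refl])
    fix i assume "i \<in> {..m}"
    then have i: "i \<le> m" by simp
    have "(of_nat (m choose (m - i)) * of_nat ((m - i) choose k) :: 'a) =
        of_nat (m choose k) * of_nat ((m - k) choose i)"
      using choose_diff_mult_choose[OF i assms] by (metis of_nat_mult)
    then show "?g (m - i) = of_nat (m choose k) *
      (of_nat ((m - k) choose i) * (fact (Suc m) / fact (Suc m - i)) * (- 1) ^ (Suc m - i))"
      unfolding Suc_diff_le[OF i] by (simp add: algebra_simps del: fact_Suc power_Suc)
  qed
  also have "\<dots> = of_nat (m choose k) * poly (poisson_charlier (Suc m) 1) (of_nat (m - k))"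
    by (simp only: poly_poisson_charlier_1_of_nat[OF diff_le_self] sum_distrib_left)
  finally show ?thesis .
qed

text \<open>Binomial theorem for \<open>(x - 1) + 1\<close>, padded with zero terms up to a bound
  independent of \<open>j\<close> so that the double sum can be swapped.\<close>

lemma power_eq_sum_choose_power_diff_1:
  fixes x :: "'a::comm_ring_1"
  assumes "j \<le> m"
  shows "x ^ j = (\<Sum>k\<le>m. of_nat (j choose k) * (x - 1) ^ k)"
proof -
  have "x ^ j = (\<Sum>k\<le>j. of_nat (j choose k) * (x - 1) ^ k)"
    using binomial_ring[of "x - 1" 1 j] by simp
  also have "\<dots> = (\<Sum>k\<le>m. of_nat (j choose k) * (x - 1) ^ k)"
    using assms by (intro sum.mono_neutral_left) (auto simp: binomial_eq_0)
  finally show ?thesis .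
qed

text \<open>The shift \<open>k = Suc j\<close> frees one factor \<open>x\<close> from each power and
  leaves its sign in the scalar.\<close>

lemma laguerre_Suc:
  "laguerre (Suc m) = [:0, 1:] * (\<Sum>j\<le>m.
    smult (of_nat (m choose j) * (fact (Suc m) / fact (Suc j)) * (- 1) ^ Suc j) ([:0, 1:] ^ j))"
proof -
  have "(- [:0, 1:]) ^ Suc j = [:0, 1:] * smult ((- 1) ^ Suc j) ([:0, 1 :: 'a:] ^ j)" for j
    by (subst power_minus) (simp add: smult_power[symmetric] power_minus[of "[:0, 1:]"]
        minus_one_power_iff)
  then show ?thesis
    unfolding laguerre_def One_nat_def sum.shift_bounds_cl_Suc_ivl atLeast0AtMost sum_distrib_left
    by (intro sum.cong) (simp_all del: fact_Suc power_Suc)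
qed

lemma smult_sum_right:
  "smult c (\<Sum>i\<in>A. p i) = (\<Sum>i\<in>A. smult c (p i))"
  by (induction A rule: infinite_finite_induct) (simp_all add: smult_add_right)

theorem theorem5:
  fixes n :: nat
  assumes "n \<ge> 1"
  shows "(laguerre n :: 'a::field_char_0 poly) =
    [:0, 1:] * (\<Sum>k = 0..n - 1.
      smult (of_nat ((n - 1) choose k) * poly (poisson_charlier n 1) (of_nat (n - 1 - k)))
        (([:0, 1:] - 1) ^ k))"
proof -
  obtain m where n: "n = Suc m"
    using assms by (cases n) auto
  \<comment> \<open>\<open>c j\<close> is the coefficient of \<open>x ^ j\<close> in the Laguerre
    polynomial divided by \<open>x\<close>.\<close>
  define c :: "nat \<Rightarrow> 'a" where
    "c j = of_nat (m choose j) * (fact (Suc m) / fact (Suc j)) * (- 1) ^ Suc j" for j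
  have "(\<Sum>j\<le>m. smult (c j) ([:0, 1:] ^ j)) =
      (\<Sum>j\<le>m. \<Sum>k\<le>m. smult (c j * of_nat (j choose k)) (([:0, 1:] - 1) ^ k))"
  proof (rule sum.cong[OF refl])
    fix j assume "j \<in> {..m}"
    then have "[:0, 1 :: 'a:] ^ j = (\<Sum>k\<le>m. of_nat (j choose k) * ([:0, 1:] - 1) ^ k)"
      by (intro power_eq_sum_choose_power_diff_1) simp
    then show "smult (c j) ([:0, 1:] ^ j) =
        (\<Sum>k\<le>m. smult (c j * of_nat (j choose k)) (([:0, 1:] - 1) ^ k))"
      by (simp add: smult_sum_right of_nat_poly)
  qed
  \<comment> \<open>Collect the terms by powers of \<open>x - 1\<close>.\<close>
  also have "\<dots> = (\<Sum>k\<le>m. smult (\<Sum>j\<le>m. c j * of_nat (j choose k)) (([:0, 1:] - 1) ^ k))"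
    by (subst sum.swap) (simp only: smult_sum)
  also have "\<dots> = (\<Sum>k\<le>m. smult (of_nat (m choose k) *
      poly (poisson_charlier (Suc m) 1) (of_nat (m - k))) (([:0, 1:] - 1) ^ k))"
    by (intro sum.cong refl) (simp only: c_def sum_laguerre_coeff_choose atMost_iff)
  finally show ?thesis
    by (simp only: n laguerre_Suc c_def diff_Suc_1 atLeast0AtMost)
qed

end
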